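(* Let $\mathcal{H}$ be a nonzero separable Hilbert space and let $E=(E_{n,k})_{n,k\geq1}$ be an infinite matrix. If $E$ defines a matrix mapping on $\bigoplus_{n=1}^\infty\mathcal{H}$, then $E$ defines a matrix mapping on $\ell^2(\mathbb{N})$.
   Context: Matrices have real or complex entries (scalars of the Hilbert space), and $\ell^2(\mathbb{N})$ is the space of square-summable scalar sequences. $\bigoplus_{n=1}^\infty\mathcal{H}$ is the Hilbert space of sequences $\{f_n\}_{n=1}^\infty$ in $\mathcal{H}$ with $\sum_n\|f_n\|^2<\infty$. $E$ defines a matrix mapping on a sequence space $\mathcal X$ if for every $x=\{x_k\}\in\mathcal X$ the series $(Ex)_n=\sum_{k=1}^\infty E_{n,k}x_k$ converges for every $n\in\mathbb{N}$ and $Ex=\{(Ex)_n\}_{n=1}^\infty\in\mathcal X$. *)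

theory Defs
  imports "HOL-Analysis.Analysis"
begin

(* The scalar fields of Hilbert spaces. Every commutative real division algebra with
   multiplicative norm is isometrically isomorphic to the reals or to the complex numbers, and the
   axioms below force conj_scalar to be complex conjugation (the identity in the real case). *)
class hilbert_scalar = real_normed_field +
  fixes conj_scalar :: "'a \<Rightarrow> 'a"
  assumes mult_conj_scalar: "x * conj_scalar x = (norm x)\<^sup>2 *\<^sub>R 1"
    and conj_scalar_zero: "conj_scalar 0 = 0"

instantiation real :: hilbert_scalar
begin
definition conj_scalar_real :: "real \<Rightarrow> real" where
  "conj_scalar_real x = x"
instance
  by standard (simp_all add: conj_scalar_real_def power2_eq_square)
end

instantiation complex :: hilbert_scalar
begin
definition conj_scalar_complex :: "complex \<Rightarrow> complex" where
  "conj_scalar_complex = cnj"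
instance
  by standard (simp_all add: conj_scalar_complex_def complex_norm_square scaleR_conv_of_real
      flip: of_real_power)
end

(* A Hilbert space over the scalars 'k, carried by the type 'h: completeness and the norm come
   from the class banach, and norm_sq says that the norm is the one induced by ip, which makes ip
   positive definite. The inner product is linear in its first argument. *)
locale hilbert_space = vector_space scl
  for scl :: "'k::hilbert_scalar \<Rightarrow> 'h::banach \<Rightarrow> 'h" +
  fixes ip :: "'h \<Rightarrow> 'h \<Rightarrow> 'k"
  assumes scale_of_real: "scl (of_real r) x = r *\<^sub>R x"
    and ip_add_left: "ip (x + y) z = ip x z + ip y z"
    and ip_scale_left: "ip (scl a x) y = a * ip x y"
    and ip_commute: "ip y x = conj_scalar (ip x y)"
    and norm_sq: "ip x x = of_real ((norm x)\<^sup>2)"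

lemma hilbert_space_real_inner:
  "hilbert_space scaleR (inner :: 'h::{real_inner,banach} \<Rightarrow> 'h \<Rightarrow> real)"
  by standard
    (simp_all add: conj_scalar_real_def inner_add_left power2_norm_eq_inner scaleR_right_distrib
      scaleR_left_distrib, rule inner_commute)

lemma hilbert_space_complex:
  "hilbert_space (*) (\<lambda>x y :: complex. x * cnj y)"
  by standard
    (simp_all add: conj_scalar_complex_def algebra_simps complex_norm_square scaleR_conv_of_real
      del: of_real_power flip: of_real_power)

(* The carrier of the Hilbert direct sum of countably many copies of 'a; for a scalar field 'a
   it is the space l2 of square-summable scalar sequences. *)
definition square_summable_seqs :: "(nat \<Rightarrow> 'a::real_normed_vector) set" where
  "square_summable_seqs = {f. summable (\<lambda>n. (norm (f n))\<^sup>2)}"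

(* Rows, columns and sequences are indexed from 0. *)
definition defines_matrix_mapping ::
  "('k \<Rightarrow> 'a \<Rightarrow> 'a) \<Rightarrow> (nat \<Rightarrow> nat \<Rightarrow> 'k) \<Rightarrow> (nat \<Rightarrow> 'a::real_normed_vector) set \<Rightarrow> bool" where
  "defines_matrix_mapping scl E X \<longleftrightarrow>
    (\<forall>x\<in>X. (\<forall>n. summable (\<lambda>k. scl (E n k) (x k))) \<and>
           (\<lambda>n. \<Sum>k. scl (E n k) (x k)) \<in> X)"

end

theory Submission
  imports Defs
begin

text \<open>
  Fix \<open>e \<noteq> 0\<close> in the Hilbert space. The map \<open>a \<mapsto> a e\<close> embeds the scalars as a line and multiplies
  norms by \<open>\<parallel>e\<parallel>\<close>, so applied entrywise it carries a square-summable scalar sequence \<open>x\<close> to a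
  square-summable sequence of vectors. The partial sums of row \<open>n\<close> of the matrix applied to the
  latter are \<open>s\<^sub>N e\<close>, where \<open>s\<^sub>N\<close> are the partial sums of row \<open>n\<close> applied to \<open>x\<close>.

  What has to be shown is that convergence of \<open>s\<^sub>N e\<close> implies convergence of \<open>s\<^sub>N\<close>, although
  completeness is not among the axioms of the scalar field. The scalar is recovered from the
  vector by the functional \<open>v \<mapsto> \<langle>v, e\<rangle> / \<parallel>e\<parallel>\<^sup>2\<close>, which is continuous by the Cauchy-Schwarz inequality
  (\<open>norm_ip_le\<close>); this is \<open>sums_of_sums_scale\<close>. The norms of the limits again differ by the factor
  \<open>\<parallel>e\<parallel>\<close>, so the scalar image sequence is square-summable because the vector one is.
\<close>

text \<open>Away from \<open>0\<close> the axioms constrain only the product \<open>x * conj_scalar x\<close>, so the value at a real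
  is found by cancelling it.\<close>

lemma conj_scalar_of_real: "conj_scalar (of_real r :: 'k::hilbert_scalar) = of_real r"
proof (cases "r = 0")
  case True
  then show ?thesis by (simp add: conj_scalar_zero)
next
  case False
  have "(of_real r :: 'k) * conj_scalar (of_real r) = of_real r * of_real r"
    by (simp add: mult_conj_scalar scaleR_conv_of_real power2_eq_square)
  then show ?thesis using False by simp
qed

context hilbert_space
begin

lemma norm_scale: "norm (scl a x) = norm a * norm x"
proof (cases "x = 0")
  case True
  then show ?thesis by (simp add: scale_zero_right)
next
  case False
  define r where "r = (norm x)\<^sup>2"
  have r: "r > 0" using False by (simp add: r_def)
  have ip_ax: "ip (scl a x) x = a * of_real r"
    by (simp add: ip_scale_left norm_sq r_def)
  have ip_xa: "ip x (scl a x) = conj_scalar (a * of_real r)"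
    by (simp only: ip_commute[of x "scl a x"] ip_ax)
  \<comment> \<open>Multiplicativity of conjugation is not an axiom: \<open>conj_scalar (a r)\<close> is only evaluated
    against its own argument \<open>a r\<close>, which costs a factor \<open>r\<close> that is cancelled below.\<close>
  have "of_real r * ip (scl a x) (scl a x)
      = (a * of_real r) * conj_scalar (a * of_real r)"
    by (simp add: ip_scale_left ip_xa)
  also have "\<dots> = of_real ((norm a)\<^sup>2 * r\<^sup>2)"
    using r by (simp add: mult_conj_scalar scaleR_conv_of_real norm_mult power_mult_distrib)
  finally have "(of_real (r * (norm (scl a x))\<^sup>2) :: 'k) = of_real ((norm a)\<^sup>2 * r\<^sup>2)"
    by (simp add: norm_sq)
  then have "r * (norm (scl a x))\<^sup>2 = (norm a)\<^sup>2 * r\<^sup>2"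
    by (simp only: of_real_eq_iff)
  then have "(norm (scl a x))\<^sup>2 = (norm a * norm x)\<^sup>2"
    using r by (simp add: power2_eq_square[of r] power_mult_distrib flip: r_def)
  then show ?thesis by simp
qed

lemma ip_diff_left: "ip (x - y) z = ip x z - ip y z"
  using ip_add_left[of "x - y" y z] by (simp add: algebra_simps)

text \<open>Cauchy-Schwarz. With \<open>a = \<langle>x, y\<rangle>\<close>, the vector \<open>z = \<parallel>y\<parallel>\<^sup>2 x - a y\<close> is orthogonal to \<open>y\<close>, and
  expanding \<open>\<langle>z, z\<rangle>\<close> gives \<open>\<parallel>z\<parallel>\<^sup>2 = \<parallel>y\<parallel>\<^sup>2 (\<parallel>x\<parallel>\<^sup>2 \<parallel>y\<parallel>\<^sup>2 - |a|\<^sup>2)\<close>, whose right-hand side is therefore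
  nonnegative.\<close>

lemma norm_ip_le: "norm (ip x y) \<le> norm x * norm y"
proof (cases "y = 0")
  case True
  then have "ip y x = 0" using ip_scale_left[of 0 y x] by simp
  then show ?thesis using ip_commute[of x y] True by (simp add: conj_scalar_zero)
next
  case False
  define r where "r = (norm y)\<^sup>2"
  have r: "r > 0" using False by (simp add: r_def)
  define a where "a = ip x y"
  define z where "z = scl (of_real r) x - scl a y"
  define d where "d = r * (norm x)\<^sup>2 - (norm a)\<^sup>2"
  have "ip z y = 0"
    by (simp add: z_def ip_diff_left ip_scale_left norm_sq a_def r_def)
  then have yz: "ip y z = 0"
    using ip_commute[of y z] by (simp add: conj_scalar_zero)
  have "a * ip y x = of_real ((norm a)\<^sup>2)"
    using ip_commute[of y x] by (simp add: a_def mult_conj_scalar scaleR_conv_of_real)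
  then have "ip z x = of_real d"
    by (simp add: z_def d_def ip_diff_left ip_scale_left norm_sq)
  then have xz: "ip x z = of_real d"
    using ip_commute[of x z] by (simp add: conj_scalar_of_real)
  have "ip z z = of_real r * ip x z - a * ip y z"
    by (subst (1) z_def) (simp add: ip_diff_left ip_scale_left)
  then have "(of_real ((norm z)\<^sup>2) :: 'k) = of_real (r * d)"
    by (simp only: xz yz norm_sq of_real_mult mult_zero_right diff_zero)
  then have "(norm z)\<^sup>2 = r * d"
    by (simp only: of_real_eq_iff)
  then have "0 \<le> d"
    using r by (metis zero_le_mult_iff zero_le_power2 not_less)
  then have "(norm a)\<^sup>2 \<le> (norm x * norm y)\<^sup>2"
    by (simp add: d_def r_def power_mult_distrib mult.commute)
  then show ?thesis
    unfolding a_def by (rule power2_le_imp_le) simp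
qed

lemma tendsto_ip_left:
  assumes "(f \<longlongrightarrow> l) F"
  shows "((\<lambda>n. ip (f n) z) \<longlongrightarrow> ip l z) F"
proof (rule metric_tendsto_imp_tendsto)
  show "((\<lambda>n. norm (f n - l) * norm z) \<longlongrightarrow> 0) F"
    using tendsto_norm_zero[OF LIM_zero[OF assms]] by (rule tendsto_mult_left_zero)
  show "\<forall>\<^sub>F n in F. dist (ip (f n) z) (ip l z) \<le> dist (norm (f n - l) * norm z) 0"
    by (simp add: dist_norm norm_ip_le flip: ip_diff_left)
qed

text \<open>Completeness of the scalars is replaced by the explicit limit \<open>\<langle>v, e\<rangle> / \<parallel>e\<parallel>\<^sup>2\<close>.\<close>

lemma sums_of_sums_scale:
  assumes "e \<noteq> 0" and v: "(\<lambda>k. scl (c k) e) sums v"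
  obtains t where "c sums t" and "norm v = norm t * norm e"
proof -
  define r :: 'k where "r = of_real ((norm e)\<^sup>2)"
  define t where "t = ip v e / r"
  have r: "r \<noteq> 0" using assms(1) by (simp add: r_def)
  have partial: "(\<lambda>N. scl (\<Sum>k<N. c k) e) \<longlonglongrightarrow> v"
    using v by (simp add: sums_def scale_sum_left)
  have "(\<lambda>N. ip (scl (\<Sum>k<N. c k) e) e / r) \<longlonglongrightarrow> t"
    unfolding t_def using r by (intro tendsto_divide tendsto_ip_left[OF partial] tendsto_const)
  then have t: "(\<lambda>N. \<Sum>k<N. c k) \<longlonglongrightarrow> t"
    using r by (simp only: ip_scale_left norm_sq flip: r_def) simp
  have "(\<lambda>N. norm (\<Sum>k<N. c k) * norm e) \<longlonglongrightarrow> norm v"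
    using tendsto_norm[OF partial] by (simp add: norm_scale)
  moreover have "(\<lambda>N. norm (\<Sum>k<N. c k) * norm e) \<longlonglongrightarrow> norm t * norm e"
    by (intro tendsto_mult tendsto_norm t tendsto_const)
  ultimately have "norm v = norm t * norm e"
    by (rule LIMSEQ_unique)
  then show ?thesis using that t by (simp add: sums_def)
qed

end

lemma square_summable_seqs_norm_scaled_iff:
  assumes "c \<noteq> 0" and "\<And>n. norm (f n) = norm (g n) * c"
  shows "f \<in> square_summable_seqs \<longleftrightarrow> g \<in> square_summable_seqs"
  using assms by (simp add: square_summable_seqs_def power_mult_distrib mult.commute[of _ "c\<^sup>2"])

theorem lemma2p3:
  fixes scl :: "'k::hilbert_scalar \<Rightarrow> 'h::banach \<Rightarrow> 'h"
    and ip :: "'h \<Rightarrow> 'h \<Rightarrow> 'k"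
    and E :: "nat \<Rightarrow> nat \<Rightarrow> 'k"
  assumes "hilbert_space scl ip"
    and "separable_space (euclidean :: 'h topology)"
    and "\<exists>x :: 'h. x \<noteq> 0"
    and "defines_matrix_mapping scl E (square_summable_seqs :: (nat \<Rightarrow> 'h) set)"
  shows "defines_matrix_mapping (*) E (square_summable_seqs :: (nat \<Rightarrow> 'k) set)"
  unfolding defines_matrix_mapping_def
proof
  interpret hilbert_space scl ip by fact
  obtain e :: 'h where e: "e \<noteq> 0" using assms(3) by blast
  fix x :: "nat \<Rightarrow> 'k"
  assume x: "x \<in> square_summable_seqs"
  define y where "y n = (\<Sum>k. scl (E n k * x k) e)" for n
  have "(\<lambda>k. scl (x k) e) \<in> square_summable_seqs"
    using x square_summable_seqs_norm_scaled_iff[of "norm e" "\<lambda>k. scl (x k) e" x] e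
    by (simp add: norm_scale)
  then have summable: "summable (\<lambda>k. scl (E n k * x k) e)" and y: "y \<in> square_summable_seqs" for n
    using assms(4) unfolding defines_matrix_mapping_def y_def by fastforce+
  have row: "summable (\<lambda>k. E n k * x k) \<and> norm (y n) = norm (\<Sum>k. E n k * x k) * norm e" for n
  proof -
    have "(\<lambda>k. scl (E n k * x k) e) sums y n"
      unfolding y_def using summable by (rule summable_sums)
    then obtain t where "(\<lambda>k. E n k * x k) sums t" "norm (y n) = norm t * norm e"
      by (rule sums_of_sums_scale[OF e])
    then show ?thesis by (simp add: sums_iff)
  qed
  then have "(\<lambda>n. \<Sum>k. E n k * x k) \<in> square_summable_seqs"
    using y e
      square_summable_seqs_norm_scaled_iff[of "norm e" y "\<lambda>n. \<Sum>k. E n k * x k"]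
    by simp
  with row show "(\<forall>n. summable (\<lambda>k. E n k * x k)) \<and>
      (\<lambda>n. \<Sum>k. E n k * x k) \<in> square_summable_seqs"
    by blast
qed

end
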